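(* Let $\mathcal{H}$ be a separable Hilbert space and let $(F,G)=(\{f_k\}_{k=1}^\infty,\{g_k\}_{k=1}^\infty)$ be a biframe for $\mathcal{H}$ with bounds $A$ and $B$. Then the following statements are true. (i) The operator $S_{F,G}$ is well-defined, bounded, positive, and invertible. (ii) $(F,G)$ is a biframe if and only if $(G,F)$ is a biframe.
   Context: A pair $(F,G)=(\{f_k\}_{k=1}^\infty,\{g_k\}_{k=1}^\infty)$ of sequences in $\mathcal{H}$ is called a biframe for $\mathcal{H}$ if there exist positive constants $A$ and $B$ (called lower and upper biframe bounds) such that $A\|f\|^2\le\sum_{k=1}^\infty\langle f,f_k\rangle\langle g_k,f\rangle\le B\|f\|^2$ for all $f\in\mathcal{H}$. For a biframe $(F,G)$, the biframe operator is $S_{F,G}:\mathcal{H}\to\mathcal{H}$, $S_{F,G}(f):=\sum_{k=1}^\infty\langle f,f_k\rangle g_k$. An operator $T$ is positive if $\langle Tf,f\rangle\ge 0$ for all $f\in\mathcal{H}$. The inner product is linear in the first variable.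
   Formalization: H is complex, and the series defining S_{F,G}(f) is taken in the weak sense (it equals the norm sum whenever that exists), because for a biframe as defined the series need not converge in norm, so S_{F,G} would not be well-defined. *)

theory Defs
  imports "HOL-Analysis.Analysis" "HOL-Library.Nonpos_Ints"
begin

text \<open>
  HOL-Analysis has only real inner product spaces. A complex one is a real one with a
  compatible complex structure, whose real inner product is the real part of the complex one;
  so \<open>norm x = sqrt (Re (cinner x x))\<close>, and all results on \<^class>\<open>real_inner\<close> apply.
  The complex inner product is linear in its first argument.
\<close>

class complex_inner = real_inner +
  fixes scaleC :: "complex \<Rightarrow> 'a \<Rightarrow> 'a"  (infixr \<open>*\<^sub>C\<close> 75)
    and cinner :: "'a \<Rightarrow> 'a \<Rightarrow> complex"
  assumes scaleC_add_right: "c *\<^sub>C (x + y) = c *\<^sub>C x + c *\<^sub>C y"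
    and scaleC_add_left: "(c + d) *\<^sub>C x = c *\<^sub>C x + d *\<^sub>C x"
    and scaleC_scaleC: "c *\<^sub>C d *\<^sub>C x = (c * d) *\<^sub>C x"
    and scaleC_of_real: "complex_of_real r *\<^sub>C x = r *\<^sub>R x"
    and cinner_commute: "cinner x y = cnj (cinner y x)"
    and cinner_add_left: "cinner (x + y) z = cinner x z + cinner y z"
    and cinner_scaleC_left: "cinner (c *\<^sub>C x) y = c * cinner x y"
    and inner_eq_Re_cinner: "inner x y = Re (cinner x y)"

class complex_hilbert = complex_inner + complete_space

instantiation complex :: complex_hilbert
begin

definition scaleC_complex :: "complex \<Rightarrow> complex \<Rightarrow> complex"
  where "scaleC_complex c x = c * x"

definition cinner_complex :: "complex \<Rightarrow> complex \<Rightarrow> complex"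
  where "cinner_complex x y = x * cnj y"

instance
  by standard
    (auto simp: scaleC_complex_def cinner_complex_def algebra_simps scaleR_conv_of_real
      inner_complex_def)

end

definition biframe_with_bounds ::
    "(nat \<Rightarrow> 'a::complex_hilbert) \<Rightarrow> (nat \<Rightarrow> 'a) \<Rightarrow> real \<Rightarrow> real \<Rightarrow> bool"
  where "biframe_with_bounds F G A B \<longleftrightarrow> A > 0 \<and> B > 0 \<and>
    (\<forall>f. \<exists>s::real. (\<lambda>k. cinner f (F k) * cinner (G k) f) sums complex_of_real s \<and>
      A * (norm f)\<^sup>2 \<le> s \<and> s \<le> B * (norm f)\<^sup>2)"

definition biframe :: "(nat \<Rightarrow> 'a::complex_hilbert) \<Rightarrow> (nat \<Rightarrow> 'a) \<Rightarrow> bool"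
  where "biframe F G \<longleftrightarrow> (\<exists>A B. biframe_with_bounds F G A B)"

definition weakly_sums :: "(nat \<Rightarrow> 'a::complex_inner) \<Rightarrow> 'a \<Rightarrow> bool"  (infix \<open>weakly'_sums\<close> 50)
  where "u weakly_sums y \<longleftrightarrow> (\<forall>h. (\<lambda>k. cinner (u k) h) sums cinner y h)"

text \<open>
  The series of the biframe operator is taken in the weak sense: for a biframe it need not
  converge in norm. With an orthonormal basis \<open>e 0, e 1, \<dots>\<close> and \<open>x \<noteq> 0\<close>, the sequences
  \<open>F = x, x, e 0, x, x, e 1, \<dots>\<close> and \<open>G = e 0, - e 0, e 0, e 1, - e 1, e 1, \<dots>\<close> form a biframe
  with bounds 1 and 1, whereas the partial sums of \<open>cinner x (F k) *\<^sub>C G k\<close> keep making steps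
  of norm \<open>(norm x)\<^sup>2\<close>. Whenever the series does converge in norm, its sum is the weak
  sum (lemma \<open>biframe_operator_eq_suminf\<close>).
\<close>

definition biframe_operator ::
    "(nat \<Rightarrow> 'a::complex_hilbert) \<Rightarrow> (nat \<Rightarrow> 'a) \<Rightarrow> 'a \<Rightarrow> 'a"
  where "biframe_operator F G f = (THE y. (\<lambda>k. cinner f (F k) *\<^sub>C G k) weakly_sums y)"

definition bounded_clinear :: "('a::complex_inner \<Rightarrow> 'b::complex_inner) \<Rightarrow> bool"
  where "bounded_clinear T \<longleftrightarrow> bounded_linear T \<and> (\<forall>c x. T (c *\<^sub>C x) = c *\<^sub>C T x)"

definition positive_operator :: "('a::complex_inner \<Rightarrow> 'a) \<Rightarrow> bool"
  where "positive_operator T \<longleftrightarrow> (\<forall>f. cinner (T f) f \<in> \<real>\<^sub>\<ge>\<^sub>0)"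

definition invertible_operator :: "('a::complex_inner \<Rightarrow> 'a) \<Rightarrow> bool"
  where "invertible_operator T \<longleftrightarrow> (\<exists>R. bounded_clinear R \<and> R \<circ> T = id \<and> T \<circ> R = id)"

lemma cinner_eq_inner:
  fixes x y :: "'a::complex_inner"
  shows "cinner x y = Complex (inner x y) (inner x (\<i> *\<^sub>C y))"
proof -
  have "cinner x (\<i> *\<^sub>C y) = cnj (\<i> * cinner y x)"
    by (metis cinner_commute cinner_scaleC_left)
  also have "\<dots> = - \<i> * cinner x y"
    by (metis cinner_commute complex_cnj_i complex_cnj_mult)
  finally have "inner x (\<i> *\<^sub>C y) = Im (cinner x y)"
    by (simp add: inner_eq_Re_cinner)
  then show ?thesis
    by (simp add: complex_eq_iff inner_eq_Re_cinner)
qed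

lemma sums_imp_weakly_sums:
  fixes u :: "nat \<Rightarrow> 'a::complex_inner"
  assumes "u sums y"
  shows "u weakly_sums y"
  unfolding weakly_sums_def cinner_eq_inner sums_complex_iff complex.sel
  using assms by (auto intro: bounded_linear.sums[OF bounded_linear_inner_left])

lemma weakly_sums_unique:
  fixes u :: "nat \<Rightarrow> 'a::complex_inner"
  assumes "u weakly_sums y" "u weakly_sums z"
  shows "y = z"
proof -
  have "cinner y (y - z) = cinner z (y - z)"
    using assms unfolding weakly_sums_def by (blast intro: sums_unique2)
  then have "inner y (y - z) = inner z (y - z)"
    unfolding inner_eq_Re_cinner by (rule arg_cong)
  then have "inner (y - z) (y - z) = 0"
    unfolding inner_diff_left by simp
  then show ?thesis
    by simp
qed

lemma biframe_operator_eq_suminf: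
  assumes "summable (\<lambda>k. cinner f (F k) *\<^sub>C G k)"
  shows "biframe_operator F G f = (\<Sum>k. cinner f (F k) *\<^sub>C G k)"
  unfolding biframe_operator_def
  using sums_imp_weakly_sums[OF summable_sums[OF assms]]
  by (blast intro: weakly_sums_unique the_equality)

end

theory Submission
  imports Defs
begin

text \<open>
  Polarization turns the convergence of \<open>\<Sum>k. \<langle>f, f\<^sub>k\<rangle>\<langle>g\<^sub>k, f\<rangle>\<close> into
  convergence of the sesquilinear form \<open>\<Sum>k. \<langle>f, f\<^sub>k\<rangle>\<langle>g\<^sub>k, h\<rangle>\<close>. Its
  diagonal values are real and lie between \<open>A \<parallel>f\<parallel>\<^sup>2\<close> and \<open>B \<parallel>f\<parallel>\<^sup>2\<close>, so it
  is Hermitian, bounded and coercive. A single variational argument, minimizing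
  \<open>a x x - 2 \<phi> x\<close> for a coercive symmetric form \<open>a\<close>, then does double duty: for the inner
  product it is the Riesz representation theorem and produces the biframe operator, and for the
  form itself it gives surjectivity. Exchanging \<open>F\<close> and \<open>G\<close> conjugates the series, whose sum
  is real.
\<close>

section \<open>Minimization of a coercive quadratic functional\<close>

text \<open>The equation for \<open>y\<close> is the Euler equation of the minimizer of
  \<open>J\<close>. Coercivity bounds \<open>J\<close> below and makes a minimizing sequence Cauchy;
  completeness supplies its limit, and continuity of \<open>J\<close> makes that limit a
  minimizer.\<close>

theorem symmetric_Lax_Milgram:
  fixes a :: "'a::{real_inner, complete_space} \<Rightarrow> 'a \<Rightarrow> real"
  assumes a: "bounded_bilinear a"
    and sym: "\<And>x y. a x y = a y x"
    and c: "c > 0" and coercive: "\<And>x. c * (norm x)\<^sup>2 \<le> a x x"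
    and \<phi>: "bounded_linear \<phi>"
  shows "\<exists>y. \<forall>h. a y h = \<phi> h"
proof -
  interpret a: bounded_bilinear a by (fact a)
  interpret \<phi>: bounded_linear \<phi> by (fact \<phi>)
  define J where "J x = a x x - 2 * \<phi> x" for x
  obtain K where K: "\<And>x. norm (\<phi> x) \<le> norm x * K"
    using \<phi>.bounded by blast
  have J_lower: "- (K\<^sup>2 / c) \<le> J x" for x
  proof -
    have "\<phi> x \<le> norm x * K"
      using K[of x] by (simp add: abs_le_iff)
    \<comment> \<open>Completing the square in \<open>norm x\<close> yields the lower bound.\<close>
    moreover have "0 \<le> (c * norm x - K)\<^sup>2 / c"
      using c by simp
    then have "0 \<le> c * (norm x)\<^sup>2 - 2 * (norm x * K) + K\<^sup>2 / c"
      using c by (simp add: power2_eq_square field_simps)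
    ultimately show ?thesis
      using coercive[of x] by (simp add: J_def)
  qed
  define m where "m = Inf (range J)"
  have bdd: "bdd_below (range J)"
    using J_lower by (rule bdd_belowI2)
  have m_le: "m \<le> J x" for x
    unfolding m_def by (rule cInf_lower[OF _ bdd]) simp
  have "\<exists>x. J x < m + inverse (real (Suc n))" for n
    using cInf_lessD[of "range J" "m + inverse (real (Suc n))"] by (auto simp: m_def)
  then obtain X where X: "\<And>n. J (X n) < m + inverse (real (Suc n))"
    by metis
  \<comment> \<open>The linear part cancels in the parallelogram identity, and \<open>J\<close> at
    the midpoint is at least \<open>m\<close>; near-minimizers are therefore close together.\<close>
  have parallelogram: "c * (norm (x - y))\<^sup>2 \<le> 2 * (J x + J y - 2 * m)" for x y
  proof -
    have "a (x - y) (x - y) = 2 * (J x + J y - 2 * J ((1/2) *\<^sub>R (x + y)))"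
      by (simp add: J_def a.add_left a.add_right a.diff_left a.diff_right a.scaleR_left
          a.scaleR_right \<phi>.add \<phi>.scaleR sym[of y x] algebra_simps)
    then show ?thesis
      using coercive[of "x - y"] m_le[of "(1/2) *\<^sub>R (x + y)"] by simp
  qed
  have "Cauchy X"
  proof (rule CauchyI)
    fix e :: real
    assume "e > 0"
    \<comment> \<open>Two excesses over \<open>m\<close>, each below this threshold, are doubled by
      \<open>parallelogram\<close> and add up to less than \<open>c\<close> times the square of
      \<open>e\<close>.\<close>
    then have "c * e\<^sup>2 / 4 > 0"
      using c by simp
    then obtain N where N: "inverse (real (Suc N)) < c * e\<^sup>2 / 4"
      using reals_Archimedean by blast
    have J_X: "J (X n) - m < c * e\<^sup>2 / 4" if "n \<ge> N" for n
    proof -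
      have "inverse (real (Suc n)) \<le> inverse (real (Suc N))"
        using that by (intro le_imp_inverse_le) auto
      then show ?thesis
        using X[of n] N by linarith
    qed
    have "norm (X i - X j) < e" if "i \<ge> N" "j \<ge> N" for i j
    proof -
      have "c * (norm (X i - X j))\<^sup>2 < c * e\<^sup>2"
        using parallelogram[of "X i" "X j"] J_X[OF that(1)] J_X[OF that(2)] by simp
      then have "(norm (X i - X j))\<^sup>2 < e\<^sup>2"
        using c by simp
      then show ?thesis
        using \<open>e > 0\<close> by (simp add: power2_less_imp_less)
    qed
    then show "\<exists>M. \<forall>i\<ge>M. \<forall>j\<ge>M. norm (X i - X j) < e"
      by blast
  qed
  then obtain y where y: "X \<longlonglongrightarrow> y"
    using Cauchy_convergent convergent_def by blast
  have "(\<lambda>n. J (X n)) \<longlonglongrightarrow> J y"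
    unfolding J_def by (intro tendsto_intros a.tendsto \<phi>.tendsto y)
  moreover have "(\<lambda>n. m + inverse (real (Suc n))) \<longlonglongrightarrow> m + 0"
    by (intro tendsto_intros LIMSEQ_inverse_real_of_nat)
  ultimately have "J y \<le> m + 0"
    using X by (intro LIMSEQ_le) (auto intro: less_imp_le)
  then have y_min: "J y \<le> J x" for x
    using m_le[of x] by simp
  have "a y h = \<phi> h" for h
  proof -
    define d where "d = a y h - \<phi> h"
    define p where "p = a h h"
    have p: "p \<ge> 0"
      using order_trans[OF _ coercive[of h]] c by (simp add: p_def)
    have quad: "0 \<le> t\<^sup>2 * p + 2 * t * d" for t
      using y_min[of "y + t *\<^sub>R h"]
      by (simp add: J_def d_def p_def a.add_left a.add_right a.scaleR_left a.scaleR_right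
          \<phi>.add \<phi>.scaleR sym[of h y] power2_eq_square algebra_simps)
    \<comment> \<open>The quadratic in \<open>t\<close> is least at \<open>- d / p\<close>; the
      denominator \<open>p + 1\<close> covers \<open>p = 0\<close> as well and still makes the value
      negative unless \<open>d = 0\<close>.\<close>
    have "0 \<le> (- d / (p + 1))\<^sup>2 * p + 2 * (- d / (p + 1)) * d"
      by (rule quad)
    also have "\<dots> = - (d\<^sup>2 * (p + 2) / (p + 1)\<^sup>2)"
      using p by (simp add: power2_eq_square divide_simps) (simp add: algebra_simps)
    finally have "d\<^sup>2 * (p + 2) / (p + 1)\<^sup>2 \<le> 0"
      by simp
    then have "d = 0"
      using p by (auto simp: divide_le_0_iff mult_le_0_iff power2_eq_square)
    then show ?thesis
      by (simp add: d_def)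
  qed
  then show ?thesis
    by blast
qed

section \<open>Complex inner product and exchange of the two sequences\<close>

lemma cinner_add_right: "cinner x (y + z) = cinner x y + cinner x z"
  for x :: "'a::complex_inner"
  by (metis cinner_commute cinner_add_left complex_cnj_add)

lemma cinner_scaleC_right: "cinner x (c *\<^sub>C y) = cnj c * cinner x y"
  for x :: "'a::complex_inner"
  by (metis cinner_commute cinner_scaleC_left complex_cnj_mult)

lemma scaleR_conv_scaleC: "r *\<^sub>R x = complex_of_real r *\<^sub>C x"
  for x :: "'a::complex_inner"
  by (simp add: scaleC_of_real)

lemma cinner_left_eqI:
  fixes x y :: "'a::complex_inner"
  assumes "\<And>h. cinner x h = cinner y h"
  shows "x = y"
proof -
  have "inner x (x - y) = inner y (x - y)"
    by (simp add: inner_eq_Re_cinner assms)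
  then have "inner (x - y) (x - y) = 0"
    unfolding inner_diff_left by simp
  then show ?thesis
    by simp
qed

lemma biframe_with_bounds_swap:
  assumes "biframe_with_bounds F G A B"
  shows "biframe_with_bounds G F A B"
  unfolding biframe_with_bounds_def
proof (intro conjI allI)
  fix f
  obtain s where s: "(\<lambda>k. cinner f (F k) * cinner (G k) f) sums complex_of_real s"
    and bounds: "A * (norm f)\<^sup>2 \<le> s" "s \<le> B * (norm f)\<^sup>2"
    using assms unfolding biframe_with_bounds_def by blast
  have "(\<lambda>k. cnj (cinner f (F k) * cinner (G k) f)) sums cnj (complex_of_real s)"
    using s by (simp only: sums_cnj)
  then have "(\<lambda>k. cinner f (G k) * cinner (F k) f) sums complex_of_real s"
    by (simp add: cinner_commute[symmetric] mult.commute)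
  then show "\<exists>s. (\<lambda>k. cinner f (G k) * cinner (F k) f) sums complex_of_real s \<and>
      A * (norm f)\<^sup>2 \<le> s \<and> s \<le> B * (norm f)\<^sup>2"
    using bounds by blast
qed (use assms in \<open>simp_all add: biframe_with_bounds_def\<close>)

lemma biframe_swap: "biframe F G \<longleftrightarrow> biframe G F"
  unfolding biframe_def using biframe_with_bounds_swap by blast

section \<open>The sesquilinear form of a biframe\<close>

locale bounded_biframe =
  fixes F G :: "nat \<Rightarrow> 'a::complex_hilbert" and A B :: real
  assumes biframe: "biframe_with_bounds F G A B"
begin

lemma A_pos: "A > 0" and B_pos: "B > 0"
  using biframe by (auto simp: biframe_with_bounds_def)

text \<open>As \<open>suminf\<close> is total, this is meaningful only once \<open>form_sums\<close>
  gives convergence.\<close>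

definition form :: "'a \<Rightarrow> 'a \<Rightarrow> complex"
  where "form f h = (\<Sum>k. cinner f (F k) * cinner (G k) h)"

lemma diagonal_sums:
  obtains s where "(\<lambda>k. cinner f (F k) * cinner (G k) f) sums complex_of_real s"
    "A * (norm f)\<^sup>2 \<le> s" "s \<le> B * (norm f)\<^sup>2"
  using biframe unfolding biframe_with_bounds_def by blast

text \<open>Polarization holds term by term: each term is a fixed combination of the diagonal terms
  at \<open>f + h\<close>, \<open>f - h\<close> and f plus or minus \<open>\<i> *\<^sub>C h\<close>,
  whose series converge by the biframe condition.\<close>

lemma form_sums: "(\<lambda>k. cinner f (F k) * cinner (G k) h) sums form f h"
proof -
  let ?t = "\<lambda>x y k. cinner x (F k) * cinner (G k) y"
  have diagonal: "summable (?t x x)" for x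
    by (metis diagonal_sums sums_summable)
  have "?t f h k = (1/4) * (?t (f + h) (f + h) k - ?t (f + (-1) *\<^sub>C h) (f + (-1) *\<^sub>C h) k
      + \<i> * ?t (f + \<i> *\<^sub>C h) (f + \<i> *\<^sub>C h) k
      - \<i> * ?t (f + (-\<i>) *\<^sub>C h) (f + (-\<i>) *\<^sub>C h) k)" for k
    by (simp add: cinner_add_left cinner_add_right cinner_scaleC_left cinner_scaleC_right
        algebra_simps)
  then have "?t f h = (\<lambda>k. (1/4) * (?t (f + h) (f + h) k
      - ?t (f + (-1) *\<^sub>C h) (f + (-1) *\<^sub>C h) k
      + \<i> * ?t (f + \<i> *\<^sub>C h) (f + \<i> *\<^sub>C h) k
      - \<i> * ?t (f + (-\<i>) *\<^sub>C h) (f + (-\<i>) *\<^sub>C h) k))"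
    by (rule ext)
  moreover have "summable \<dots>"
    by (intro summable_mult summable_add summable_diff diagonal)
  ultimately have "summable (?t f h)"
    by metis
  then show ?thesis
    unfolding form_def by (rule summable_sums)
qed

lemma form_add_left: "form (f + g) h = form f h + form g h"
  using sums_add[OF form_sums[of f h] form_sums[of g h]] form_sums[of "f + g" h]
  by (auto simp: cinner_add_left algebra_simps intro: sums_unique2)

lemma form_add_right: "form f (g + h) = form f g + form f h"
  using sums_add[OF form_sums[of f g] form_sums[of f h]] form_sums[of f "g + h"]
  by (auto simp: cinner_add_right algebra_simps intro: sums_unique2)

lemma form_scaleC_left: "form (c *\<^sub>C f) h = c * form f h"
  using sums_mult[OF form_sums[of f h], of c] form_sums[of "c *\<^sub>C f" h]
  by (auto simp: cinner_scaleC_left mult_ac intro: sums_unique2)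

lemma form_scaleC_right: "form f (c *\<^sub>C h) = cnj c * form f h"
  using sums_mult[OF form_sums[of f h], of "cnj c"] form_sums[of f "c *\<^sub>C h"]
  by (auto simp: cinner_scaleC_right mult_ac intro: sums_unique2)

lemma form_diagonal:
  "Im (form f f) = 0" "A * (norm f)\<^sup>2 \<le> Re (form f f)" "Re (form f f) \<le> B * (norm f)\<^sup>2"
proof -
  obtain s where "(\<lambda>k. cinner f (F k) * cinner (G k) f) sums complex_of_real s"
    "A * (norm f)\<^sup>2 \<le> s" "s \<le> B * (norm f)\<^sup>2"
    by (rule diagonal_sums)
  moreover from this(1) have "form f f = complex_of_real s"
    using form_sums sums_unique2 by blast
  ultimately show "Im (form f f) = 0" "A * (norm f)\<^sup>2 \<le> Re (form f f)"
    "Re (form f f) \<le> B * (norm f)\<^sup>2"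
    by simp_all
qed

text \<open>The diagonal value at \<open>f + \<i> *\<^sub>C h\<close> is real, and its imaginary
  part is \<open>Re (form h f) - Re (form f h)\<close>.\<close>

lemma Re_form_commute: "Re (form f h) = Re (form h f)"
  using form_diagonal(1)[of "f + \<i> *\<^sub>C h"] form_diagonal(1)[of f] form_diagonal(1)[of h]
  by (simp add: form_add_left form_add_right form_scaleC_left form_scaleC_right)

text \<open>For unit vectors, positivity at \<open>x - y\<close> bounds twice the mixed term by the
  two diagonal values, hence by \<open>2 * B\<close>. Homogeneity gives general vectors, and
  replacing \<open>f\<close> by \<open>- f\<close> the absolute value.\<close>

lemma Re_form_bound: "\<bar>Re (form f h)\<bar> \<le> norm f * norm h * B"
proof -
  have sub: "Re (form (- x) y) = - Re (form x y)" for x y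
    using form_scaleC_left[of "-1" x y] scaleC_of_real[of "-1" x] by simp
  have unit: "Re (form x y) \<le> B" if "norm x = 1" "norm y = 1" for x y
  proof -
    have "0 \<le> A * (norm (x - y))\<^sup>2"
      using A_pos by simp
    then have "0 \<le> Re (form (x + - y) (x + - y))"
      using form_diagonal(2)[of "x - y"] by simp
    moreover have "Re (form (- y) (- y)) = Re (form y y)"
      using sub Re_form_commute by (metis minus_minus)
    moreover have "Re (form x (- y)) = - Re (form x y)"
      using sub Re_form_commute by metis
    ultimately have "2 * Re (form x y) \<le> Re (form x x) + Re (form y y)"
      using sub[of y x] Re_form_commute[of y x]
      by (simp add: form_add_left form_add_right del: add_uminus_conv_diff)
    then show ?thesis
      using form_diagonal(3)[of x] form_diagonal(3)[of y] that by simp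
  qed
  have upper: "Re (form x y) \<le> norm x * norm y * B" for x y
  proof (cases "x = 0 \<or> y = 0")
    case True
    have "form 0 z = 0" "form z 0 = 0" for z
      using form_add_left[of 0 0 z] form_add_right[of z 0 0] by simp_all
    then show ?thesis
      using True by auto
  next
    case False
    let ?x = "inverse (norm x) *\<^sub>R x" and ?y = "inverse (norm y) *\<^sub>R y"
    have "x = norm x *\<^sub>R ?x" "y = norm y *\<^sub>R ?y"
      using False by simp_all
    then have "Re (form x y) = Re (form (norm x *\<^sub>R ?x) (norm y *\<^sub>R ?y))"
      by simp
    also have "\<dots> = norm x * norm y * Re (form ?x ?y)"
      unfolding scaleR_conv_scaleC by (simp only: form_scaleC_left form_scaleC_right) simp
    also have "\<dots> \<le> norm x * norm y * B"
      using False by (intro mult_left_mono unit) auto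
    finally show ?thesis .
  qed
  show ?thesis
    using upper[of f h] upper[of "- f" h] by (simp add: sub abs_le_iff)
qed

text \<open>Passing to the real part over the underlying real space reaches the setting of
  \<open>symmetric_Lax_Milgram\<close>.\<close>

lemma bounded_bilinear_Re_form: "bounded_bilinear (\<lambda>f h. Re (form f h))"
proof
  show "\<exists>K. \<forall>f h. norm (Re (form f h)) \<le> norm f * norm h * K"
    using Re_form_bound by auto
qed (simp_all add: form_add_left form_add_right scaleR_conv_scaleC form_scaleC_left
    form_scaleC_right)

section \<open>The biframe operator: existence, bounds and inverse\<close>

abbreviation S :: "'a \<Rightarrow> 'a"
  where "S \<equiv> biframe_operator F G"

lemma ex_weakly_sums: "\<exists>!y. (\<lambda>k. cinner f (F k) *\<^sub>C G k) weakly_sums y"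
proof -
  have "\<exists>y. \<forall>h. inner y h = Re (form f h)"
  \<comment> \<open>With \<open>a = inner\<close> this is Riesz representation.\<close>
  proof (rule symmetric_Lax_Milgram[where a = inner and c = 1 and \<phi> = "\<lambda>h. Re (form f h)"])
    show "bounded_linear (\<lambda>h. Re (form f h))"
      using bounded_bilinear_Re_form by (rule bounded_bilinear.bounded_linear_right)
  qed (auto simp: bounded_bilinear_inner inner_commute power2_norm_eq_inner)
  then obtain y where y: "\<And>h. inner y h = Re (form f h)"
    by blast
  \<comment> \<open>Imaginary parts agree too: they are the real parts at
    \<open>\<i> *\<^sub>C h\<close>.\<close>
  have "cinner y h = form f h" for h
    by (simp add: cinner_eq_inner y form_scaleC_right complex_eq_iff)
  then have "(\<lambda>k. cinner f (F k) *\<^sub>C G k) weakly_sums y"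
    using form_sums by (simp add: weakly_sums_def cinner_scaleC_left)
  then show ?thesis
    using weakly_sums_unique by blast
qed

text \<open>Unique existence makes the \<open>THE\<close> in \<open>biframe_operator\<close> denote
  the weak sum; properties of \<open>S\<close> can now be read off \<open>form\<close>.\<close>

lemma cinner_operator: "cinner (S f) h = form f h"
proof -
  have "(\<lambda>k. cinner f (F k) *\<^sub>C G k) weakly_sums S f"
    unfolding biframe_operator_def using ex_weakly_sums by (rule theI')
  then show ?thesis
    using form_sums sums_unique2 by (fastforce simp: weakly_sums_def cinner_scaleC_left)
qed

lemma inner_operator: "inner (S f) h = Re (form f h)"
  by (simp add: inner_eq_Re_cinner cinner_operator)

lemma operator_add: "S (f + g) = S f + S g"
  by (rule cinner_left_eqI) (simp add: cinner_operator cinner_add_left form_add_left)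

lemma operator_scaleC: "S (c *\<^sub>C f) = c *\<^sub>C S f"
  by (rule cinner_left_eqI) (simp add: cinner_operator cinner_scaleC_left form_scaleC_left)

text \<open>Test \<open>Re_form_bound\<close> with \<open>h = S f\<close> and cancel one factor
  \<open>norm (S f)\<close>.\<close>

lemma norm_operator_le: "norm (S f) \<le> norm f * B"
proof (cases "S f = 0")
  case False
  have "(norm (S f))\<^sup>2 \<le> norm f * norm (S f) * B"
    using Re_form_bound[of f "S f"] by (simp add: power2_norm_eq_inner inner_operator)
  then show ?thesis
    using False by (simp add: power2_eq_square mult.commute mult.left_commute)
qed (use B_pos in simp)

text \<open>Cauchy-Schwarz against the lower biframe bound; this yields both injectivity and the
  bound on the inverse.\<close>

lemma norm_operator_ge: "A * norm f \<le> norm (S f)"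
proof (cases "f = 0")
  case False
  have "A * (norm f)\<^sup>2 \<le> inner (S f) f"
    using form_diagonal(2) by (simp add: inner_operator)
  also have "\<dots> \<le> norm (S f) * norm f"
    by (rule norm_cauchy_schwarz)
  finally show ?thesis
    using False by (simp add: power2_eq_square mult.assoc[symmetric])
qed simp

lemma bounded_clinear_operator: "bounded_clinear S"
  unfolding bounded_clinear_def
  by (auto intro!: bounded_linear_intro[of _ B] norm_operator_le
      simp: operator_add operator_scaleC scaleR_conv_scaleC)

lemma positive_operator_operator: "positive_operator S"
  unfolding positive_operator_def
proof
  fix f
  have "0 \<le> Re (form f f)"
    using order_trans[OF _ form_diagonal(2)[of f]] A_pos by simp
  then show "cinner (S f) f \<in> \<real>\<^sub>\<ge>\<^sub>0"
    using form_diagonal(1) by (simp add: cinner_operator complex_nonneg_Reals_iff)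
qed

lemma bij_operator: "bij S"
proof (rule bijI)
  interpret S: bounded_linear S
    using bounded_clinear_operator by (simp add: bounded_clinear_def)
  have "f = 0" if "S f = 0" for f
    using norm_operator_ge[of f] that A_pos by (simp add: mult_le_0_iff)
  then show "inj S"
    using linear_injective_0[OF S.linear_axioms] by blast
  show "surj S"
    unfolding surj_def
  proof
    fix g
    \<comment> \<open>Here the variational argument runs on the form itself, with coercivity
      constant \<open>A\<close>.\<close>
    have "\<exists>y. \<forall>h. Re (form y h) = inner g h"
      using bounded_bilinear_Re_form Re_form_commute A_pos form_diagonal(2)
        bounded_linear_inner_right[of g]
      by (rule symmetric_Lax_Milgram)
    then obtain y where y: "\<And>h. Re (form y h) = inner g h"
      by blast
    have "S y = g"
      by (rule cinner_left_eqI) (simp add: cinner_eq_inner inner_operator y)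
    then show "\<exists>y. g = S y"
      by blast
  qed
qed

lemma invertible_operator_operator: "invertible_operator S"
  unfolding invertible_operator_def
proof (intro exI conjI)
  let ?R = "inv S"
  have SR: "S (?R x) = x" for x
    using bij_operator by (simp add: bij_is_surj surj_f_inv_f)
  have RS: "?R (S x) = x" for x
    using bij_operator by (simp add: bij_is_inj)
  have scaleC: "?R (c *\<^sub>C x) = c *\<^sub>C ?R x" for c x
    using RS[of "c *\<^sub>C ?R x"] by (simp only: operator_scaleC SR)
  have "bounded_linear ?R"
  proof (rule bounded_linear_intro)
    show "?R (x + y) = ?R x + ?R y" for x y
      using RS[of "?R x + ?R y"] by (simp only: operator_add SR)
    show "?R (r *\<^sub>R x) = r *\<^sub>R ?R x" for r x
      by (simp add: scaleR_conv_scaleC scaleC)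
    \<comment> \<open>The lower bound for \<open>S\<close> at \<open>?R x\<close> bounds the
      inverse.\<close>
    show "norm (?R x) \<le> norm x * inverse A" for x
      using norm_operator_ge[of "?R x"] A_pos by (simp add: SR field_simps)
  qed
  then show "bounded_clinear ?R"
    using scaleC by (simp add: bounded_clinear_def)
  show "?R \<circ> S = id" "S \<circ> ?R = id"
    by (auto simp: RS SR)
qed

end

theorem theorem4p2:
  fixes F G :: "nat \<Rightarrow> 'a::complex_hilbert" and A B :: real
  assumes "separable_space (euclidean :: 'a topology)"
    and "biframe_with_bounds F G A B"
  shows "((\<forall>f. \<exists>!y. (\<lambda>k. cinner f (F k) *\<^sub>C G k) weakly_sums y) \<and>
          bounded_clinear (biframe_operator F G) \<and>
          positive_operator (biframe_operator F G) \<and>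
          invertible_operator (biframe_operator F G)) \<and>
         (biframe F G \<longleftrightarrow> biframe G F)"
proof -
  interpret bounded_biframe F G A B
    by unfold_locales (fact assms(2))
  show ?thesis
    by (intro conjI allI ex_weakly_sums bounded_clinear_operator positive_operator_operator
        invertible_operator_operator biframe_swap)
qed

end
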